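(* Let $B>0$, $d\in\mathbb{N}^*$, $\mathcal{Y}=[-B;B]$, and let the loss be $\ell(y,y')=|y-y'|^q$. For any training set size $n\in\mathbb{N}^*$, any $q>1+\sqrt{\frac{\lfloor\log_2d\rfloor}{4n}\wedge1}$, and any input space $\mathcal{X}$ containing at least $\lfloor\log_2(2d)\rfloor$ points, there exists a set $\mathcal{G}$ of $d$ prediction functions such that: for any estimator $\hat g$ there exists a probability distribution on the data space $\mathcal{X}\times[-B;B]$ for which $$\mathbb{E}R(\hat g)-\min_{g\in\mathcal{G}}R(g)\ge\left(\frac{q}{90(q-1)}\vee e^{-1}\right)B^q\left(\frac{\lfloor\log_2|\mathcal{G}|\rfloor}{n+1}\wedge1\right).$$
   Context: Prediction functions are (measurable) functions $\mathcal{X}\to\mathcal{Y}$. For a distribution $P$ on $\mathcal{X}\times\mathcal{Y}$, $R(g)=\mathbb{E}_{(X,Y)\sim P}|Y-g(X)|^q$. An estimator $\hat g$ maps a training set $Z_1^n\in(\mathcal{X}\times\mathcal{Y})^n$ to a prediction function $\hat g_{Z_1^n}$; $\mathbb{E}R(\hat g)=\mathbb{E}_{Z_1^n\sim P^{\otimes n}}R(\hat g_{Z_1^n})$. $\lfloor x\rfloor$ is the largest integer not exceeding $x$, $a\wedge b=\min(a,b)$, $a\vee b=\max(a,b)$, and $|\mathcal{G}|$ is the cardinality of $\mathcal{G}$ (here $|\mathcal{G}|=d$). Measurability of the manipulated quantities is implicitly assumed.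
   Formalization: The input space is assumed to carry a sigma-algebra that separates its points (with the trivial sigma-algebra the bound fails, e.g. d=16, n=3, q=2); estimators are jointly measurable in the training set and the input. *)

theory Defs
  imports "HOL-Probability.Probability"
begin

text \<open>
  The input space is a measurable space \<open>M\<close>, i.e. a \<^typ>\<open>'x measure\<close> of which only the carrier and
  the \<open>\<sigma>\<close>-algebra are used.  The output space is the interval from \<open>-B\<close> to \<open>B\<close> with its Borel sets.
\<close>

definition output_space :: "real \<Rightarrow> real measure"
  where "output_space B = restrict_space borel {-B..B}"

definition data_space :: "'x measure \<Rightarrow> real \<Rightarrow> ('x \<times> real) measure"
  where "data_space M B = M \<Otimes>\<^sub>M output_space B"

text \<open>
  Extensionality makes HOL equality of prediction functions coincide with equality on the input
  space, so that the cardinality of a set of them is the intended one.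
\<close>

definition prediction_functions :: "'x measure \<Rightarrow> real \<Rightarrow> ('x \<Rightarrow> real) set"
  where "prediction_functions M B = measurable M (output_space B) \<inter> extensional (space M)"

text \<open>A training set of size \<open>n\<close> is a family of data points indexed by \<open>{..<n}\<close>.\<close>

definition training_space :: "'x measure \<Rightarrow> real \<Rightarrow> nat \<Rightarrow> (nat \<Rightarrow> 'x \<times> real) measure"
  where "training_space M B n = (\<Pi>\<^sub>M i\<in>{..<n}. data_space M B)"

text \<open>
  Joint measurability is the usual requirement under which the risk of the fitted function is a
  random variable of the training set, whatever the data distribution.
\<close>

definition estimator ::
    "'x measure \<Rightarrow> real \<Rightarrow> nat \<Rightarrow> ((nat \<Rightarrow> 'x \<times> real) \<Rightarrow> 'x \<Rightarrow> real) \<Rightarrow> bool"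
  where "estimator M B n ghat \<longleftrightarrow>
    (\<forall>z \<in> space (training_space M B n). ghat z \<in> prediction_functions M B) \<and>
    (\<lambda>(z, x). ghat z x) \<in> measurable (training_space M B n \<Otimes>\<^sub>M M) (output_space B)"

definition data_distribution :: "'x measure \<Rightarrow> real \<Rightarrow> ('x \<times> real) measure \<Rightarrow> bool"
  where "data_distribution M B P \<longleftrightarrow> prob_space P \<and> sets P = sets (data_space M B)"

definition loss :: "real \<Rightarrow> real \<Rightarrow> real \<Rightarrow> real"
  where "loss q y y' = \<bar>y - y'\<bar> powr q"

definition risk :: "real \<Rightarrow> ('x \<times> real) measure \<Rightarrow> ('x \<Rightarrow> real) \<Rightarrow> real"
  where "risk q P g = (\<integral>(x, y). loss q y (g x) \<partial>P)"

definition expected_risk ::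
    "real \<Rightarrow> nat \<Rightarrow> ('x \<times> real) measure \<Rightarrow> ((nat \<Rightarrow> 'x \<times> real) \<Rightarrow> 'x \<Rightarrow> real) \<Rightarrow> real"
  where "expected_risk q n P ghat = (\<integral>z. risk q P (ghat z) \<partial>(\<Pi>\<^sub>M i\<in>{..<n}. P))"

text \<open>
  Points that no measurable set tells apart are the same point for every measurable function and
  every distribution.  The condition holds in particular if all singletons are measurable.
\<close>

definition separates_points :: "'x measure \<Rightarrow> bool"
  where "separates_points M \<longleftrightarrow>
    (\<forall>x \<in> space M. \<forall>y \<in> space M. x \<noteq> y \<longrightarrow> (\<exists>A \<in> sets M. x \<in> A \<and> y \<notin> A))"

end

theory Submission
  imports Defs
begin

text \<open>
  Put mass \<open>w\<close> on each of \<open>m\<close> points of the input space and the rest on one further point, and let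
  the output be \<open>\<plusminus> B\<close>, the more likely sign having probability \<open>p\<close>.  The \<open>2 ^ m\<close> ways of choosing
  this sign at the \<open>m\<close> points give a hypercube of distributions, and \<open>G\<close> contains all the optimal
  predictors, whose values are \<open>\<plusminus> b\<close>.  Averaging over the hypercube (Assouad's lemma), each of the
  \<open>m\<close> points contributes \<open>w\<close> times the regret of not knowing the sign, times the affinity of the
  laws of two samples that differ in one sign.

  Deterministic outputs (\<open>p = 1\<close>) with \<open>w = 1 / (n + 1)\<close> give the constant \<open>exp (- 1)\<close>, the
  probability of never observing a given point being \<open>(1 - w) ^ n\<close>.  For \<open>q\<close> close to 1, put
  \<open>\<epsilon> = q - 1\<close> and take \<open>p / (1 - p) = exp (4 * \<epsilon>)\<close>, for which \<open>b = B * tanh 2\<close>.  The regret is then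
  of order \<open>\<epsilon>\<close>, the two laws have squared Hellinger distance of order \<open>w * \<epsilon>\<^sup>2\<close>, and
  \<open>w = 1 / (4 * n * \<epsilon>\<^sup>2)\<close> gives the constant \<open>q / (90 * (q - 1))\<close>.
\<close>

section \<open>Inequalities for powers\<close>

text \<open>A convex function lies above its tangents. Convexity and the derivative are used on the
  open half line, so the boundary cases \<open>a = 0\<close> and \<open>x = 0\<close> are treated by
  hand.\<close>

lemma powr_above_tangent:
  fixes a x q :: real
  assumes "a \<ge> 0" "x \<ge> 0" "q \<ge> 1"
  shows "x powr q \<ge> a powr q + q * a powr (q - 1) * (x - a)"
proof -
  consider "a = 0" | "a > 0" "x = 0" | "a > 0" "x > 0"
    using assms by linarith
  then show ?thesis
  proof cases
    \<comment> \<open>\<open>0 powr r\<close> is 0 even for \<open>r = 0\<close>, so the right side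
      vanishes also when \<open>q = 1\<close>.\<close>
    case 1
    then show ?thesis by simp
  next
    case 2
    have "a powr q = a powr (q - 1) * a"
      using 2 by (simp add: powr_diff)
    moreover have "a powr (q - 1) * a * 1 \<le> a powr (q - 1) * a * q"
      using 2 assms by (intro mult_left_mono) auto
    ultimately show ?thesis
      using 2 by (simp add: algebra_simps)
  next
    case 3
    have "((\<lambda>x. x powr q) has_real_derivative q * a powr (q - 1)) (at a within {0<..})"
      using 3 by (auto intro!: derivative_eq_intros)
    moreover have "a \<in> interior {0<..}"
      using 3 by (simp add: interior_open)
    ultimately have "x powr q - a powr q \<ge> q * a powr (q - 1) * (x - a)"
      using 3 powr_convex[OF \<open>q \<ge> 1\<close>]
      by (intro convex_on_imp_above_tangent[where A="{0<..}"]) auto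
    then show ?thesis
      by simp
  qed
qed

text \<open>\<open>stationary\<close> says that the derivative of the right side vanishes at
  \<open>y = b\<close>. The tangent bounds at \<open>b\<close> for the two summands therefore add up
  with cancelling linear terms.\<close>

lemma weighted_powr_ge:
  fixes B b p q y :: real
  assumes q: "q \<ge> 1" and p: "0 \<le> p" "p \<le> 1" and b: "\<bar>b\<bar> \<le> B" and y: "\<bar>y\<bar> \<le> B"
    and stationary: "p * (B - b) powr (q - 1) = (1 - p) * (B + b) powr (q - 1)"
  shows "p * (B - b) powr q + (1 - p) * (B + b) powr q
    \<le> p * (B - y) powr q + (1 - p) * (B + y) powr q"
proof -
  have "p * ((B - b) powr q + q * (B - b) powr (q - 1) * (b - y)) \<le> p * (B - y) powr q"
    using powr_above_tangent[of "B - b" "B - y" q] assms by (intro mult_left_mono) auto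
  moreover have "(1 - p) * ((B + b) powr q + q * (B + b) powr (q - 1) * (y - b))
      \<le> (1 - p) * (B + y) powr q"
    using powr_above_tangent[of "B + b" "B + y" q] assms by (intro mult_left_mono) auto
  moreover have "p * (q * (B - b) powr (q - 1) * (b - y))
      + (1 - p) * (q * (B + b) powr (q - 1) * (y - b)) = 0"
  proof -
    have "p * (q * (B - b) powr (q - 1) * (b - y))
      + (1 - p) * (q * (B + b) powr (q - 1) * (y - b))
      = q * (b - y) * (p * (B - b) powr (q - 1) - (1 - p) * (B + b) powr (q - 1))"
      by (simp add: algebra_simps)
    then show ?thesis using stationary by simp
  qed
  ultimately show ?thesis
    by (simp add: distrib_left)
qed

lemma sum_powr_ge:
  fixes B q y :: real
  assumes "q \<ge> 1" "\<bar>y\<bar> \<le> B"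
  shows "2 * B powr q \<le> (B - y) powr q + (B + y) powr q"
  using weighted_powr_ge[of q "1/2" 0 B y] assms abs_ge_zero[of y] by simp

text \<open>For \<open>n > 0\<close>, \<open>1 - 1 / (n + 1)\<close> is the reciprocal of
  \<open>1 + 1 / n\<close>, whose \<open>n\<close>-th power is at most \<open>exp 1\<close>.\<close>

lemma exp_minus_1_le_power:
  "exp (- 1) \<le> (1 - 1 / (real n + 1)) ^ n"
proof -
  have "(1 + 1 / real n) ^ n \<le> exp 1" if "n > 0"
    using exp_ge_one_plus_x_over_n_power_n[of n 1] that by simp
  moreover have "1 - 1 / (real n + 1) = inverse (1 + 1 / real n)" if "n > 0"
    using that by (simp add: field_simps)
  ultimately show ?thesis
    by (cases "n = 0")
      (auto simp: inverse_le_1_iff exp_minus power_inverse intro!: le_imp_inverse_le zero_less_power add_pos_nonneg)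
qed

section \<open>Overlap of product laws\<close>

text \<open>The power expands into a sum over sequences, and a product of minima is below both
  products.\<close>

lemma power_sum_min_le:
  fixes f g :: "'a \<Rightarrow> real"
  assumes "finite \<Omega>" "\<And>x. x \<in> \<Omega> \<Longrightarrow> f x \<ge> 0" "\<And>x. x \<in> \<Omega> \<Longrightarrow> g x \<ge> 0"
  shows "(\<Sum>x\<in>\<Omega>. min (f x) (g x)) ^ n
    \<le> (\<Sum>z\<in>{..<n} \<rightarrow>\<^sub>E \<Omega>. min (\<Prod>i<n. f (z i)) (\<Prod>i<n. g (z i)))"
proof -
  have "(\<Sum>x\<in>\<Omega>. min (f x) (g x)) ^ n = (\<Sum>z\<in>{..<n} \<rightarrow>\<^sub>E \<Omega>. \<Prod>i<n. min (f (z i)) (g (z i)))"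
    using assms(1) prod_sum_PiE[of "{..<n}" "\<lambda>_. \<Omega>" "\<lambda>_ x. min (f x) (g x)"] by simp
  also have "\<dots> \<le> (\<Sum>z\<in>{..<n} \<rightarrow>\<^sub>E \<Omega>. min (\<Prod>i<n. f (z i)) (\<Prod>i<n. g (z i)))"
    using assms by (intro sum_mono min.boundedI prod_mono) auto
  finally show ?thesis .
qed

text \<open>Le Cam's inequality. The Bhattacharyya coefficient is multiplicative over products;
  writing \<open>F z * G z\<close> as minimum times maximum, Cauchy-Schwarz bounds its square by the
  overlap times the sum of the maxima, which is at most 2.\<close>

lemma power_sum_sqrt_le:
  fixes f g :: "'a \<Rightarrow> real"
  assumes fin: "finite \<Omega>" and f: "\<And>x. x \<in> \<Omega> \<Longrightarrow> f x \<ge> 0" and g: "\<And>x. x \<in> \<Omega> \<Longrightarrow> g x \<ge> 0"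
    and "sum f \<Omega> = 1" "sum g \<Omega> = 1"
  shows "((\<Sum>x\<in>\<Omega>. sqrt (f x * g x)) ^ n)\<^sup>2 / 2
    \<le> (\<Sum>z\<in>{..<n} \<rightarrow>\<^sub>E \<Omega>. min (\<Prod>i<n. f (z i)) (\<Prod>i<n. g (z i)))"
proof -
  define Z where "Z = {..<n} \<rightarrow>\<^sub>E \<Omega>"
  define F where "F z = (\<Prod>i<n. f (z i))" for z
  define G where "G z = (\<Prod>i<n. g (z i))" for z
  have pos: "F z \<ge> 0" "G z \<ge> 0" if "z \<in> Z" for z
    using that f g by (auto simp: F_def G_def Z_def PiE_iff intro!: prod_nonneg)
  have sums: "sum F Z = 1" "sum G Z = 1"
    using fin assms(4,5) prod_sum_PiE[of "{..<n}" "\<lambda>_. \<Omega>" "\<lambda>_. f"]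
      prod_sum_PiE[of "{..<n}" "\<lambda>_. \<Omega>" "\<lambda>_. g"] by (simp_all add: F_def G_def Z_def)
  have "(\<Sum>x\<in>\<Omega>. sqrt (f x * g x)) ^ n = (\<Sum>z\<in>Z. \<Prod>i<n. sqrt (f (z i) * g (z i)))"
    using fin prod_sum_PiE[of "{..<n}" "\<lambda>_. \<Omega>" "\<lambda>_ x. sqrt (f x * g x)"] by (simp add: Z_def)
  also have "\<dots> = (\<Sum>z\<in>Z. sqrt (min (F z) (G z)) * sqrt (max (F z) (G z)))"
  proof (intro sum.cong refl)
    fix z
    have "(\<Prod>i<n. sqrt (f (z i) * g (z i))) = sqrt (F z * G z)"
      unfolding F_def G_def by (induction n) (simp_all add: real_sqrt_mult)
    also have "F z * G z = min (F z) (G z) * max (F z) (G z)"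
      by (simp add: min_def max_def)
    finally show "(\<Prod>i<n. sqrt (f (z i) * g (z i))) = sqrt (min (F z) (G z)) * sqrt (max (F z) (G z))"
      by (simp add: real_sqrt_mult)
  qed
  finally have "((\<Sum>x\<in>\<Omega>. sqrt (f x * g x)) ^ n)\<^sup>2
    \<le> (\<Sum>z\<in>Z. (sqrt (min (F z) (G z)))\<^sup>2) * (\<Sum>z\<in>Z. (sqrt (max (F z) (G z)))\<^sup>2)"
    using Cauchy_Schwarz_ineq_sum by metis
  also have "\<dots> = (\<Sum>z\<in>Z. min (F z) (G z)) * (\<Sum>z\<in>Z. max (F z) (G z))"
    using pos by (intro arg_cong2[where f="(*)"] sum.cong) (auto simp: le_max_iff_disj)
  also have "\<dots> \<le> (\<Sum>z\<in>Z. min (F z) (G z)) * 2"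
  proof (intro mult_left_mono sum_nonneg)
    have "(\<Sum>z\<in>Z. max (F z) (G z)) \<le> (\<Sum>z\<in>Z. F z + G z)"
      using pos by (intro sum_mono) auto
    then show "(\<Sum>z\<in>Z. max (F z) (G z)) \<le> 2"
      using sums by (simp add: sum.distrib)
  qed (use pos in auto)
  finally show ?thesis
    by (simp add: Z_def F_def G_def)
qed

section \<open>Assouad's lemma\<close>

lemma sum_Pow_split:
  fixes F :: "'a set \<Rightarrow> real"
  assumes "finite S" "j \<in> S"
  shows "(\<Sum>T\<in>Pow S. F T) = (\<Sum>T\<in>Pow (S - {j}). F T + F (insert j T))"
proof -
  have "Pow S = Pow (S - {j}) \<union> insert j ` Pow (S - {j})"
    using assms Pow_insert[of j "S - {j}"] by (simp add: insert_absorb)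
  moreover have "inj_on (insert j) (Pow (S - {j}))"
    by (auto simp: inj_on_def)
  moreover have "Pow (S - {j}) \<inter> insert j ` Pow (S - {j}) = {}"
    by auto
  ultimately show ?thesis
    using assms(1) by (simp add: sum.union_disjoint sum.reindex sum.distrib)
qed

text \<open>\<open>D T z\<close> stands for the likelihood of the sample \<open>z\<close> at the
  vertex \<open>T\<close>, \<open>e s z j\<close> for the regret at coordinate \<open>j\<close> when
  its true sign is \<open>s\<close>. On an edge in direction \<open>j\<close> the regrets for the
  two signs cannot both be small, so the common part of the two laws contributes at least
  \<open>2 * \<Delta>\<close> times its mass. Some vertex is at least as bad as the average over all
  vertices.\<close>

lemma assouad:
  fixes D :: "nat set \<Rightarrow> 'z \<Rightarrow> real" and e :: "bool \<Rightarrow> 'z \<Rightarrow> nat \<Rightarrow> real"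
  assumes D: "\<And>T z. T \<subseteq> {..<m} \<Longrightarrow> z \<in> Z \<Longrightarrow> D T z \<ge> 0"
    and e: "\<And>s z j. z \<in> Z \<Longrightarrow> j < m \<Longrightarrow> e s z j \<ge> 0"
    and gap: "\<And>z j. z \<in> Z \<Longrightarrow> j < m \<Longrightarrow> e True z j + e False z j \<ge> 2 * \<Delta>"
    and "\<Delta> \<ge> 0"
    and affinity: "\<And>T j. T \<subseteq> {..<m} - {j} \<Longrightarrow> j < m \<Longrightarrow>
      A \<le> (\<Sum>z\<in>Z. min (D T z) (D (insert j T) z))"
  shows "\<exists>T\<subseteq>{..<m}. (\<Sum>z\<in>Z. D T z * (\<Sum>j<m. e (j \<in> T) z j)) \<ge> real m * \<Delta> * A"
proof -
  define F where "F T j = (\<Sum>z\<in>Z. D T z * e (j \<in> T) z j)" for T j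
  have F_pair: "F T j + F (insert j T) j \<ge> 2 * \<Delta> * A" if "T \<subseteq> {..<m} - {j}" "j < m" for T j
  proof -
    have "2 * \<Delta> * A \<le> 2 * \<Delta> * (\<Sum>z\<in>Z. min (D T z) (D (insert j T) z))"
      using affinity[OF that] \<open>\<Delta> \<ge> 0\<close> by (intro mult_left_mono) auto
    also have "\<dots> = (\<Sum>z\<in>Z. min (D T z) (D (insert j T) z) * (2 * \<Delta>))"
      by (simp add: sum_distrib_left mult.commute)
    also have "\<dots> \<le> (\<Sum>z\<in>Z. D T z * e False z j + D (insert j T) z * e True z j)"
    proof (intro sum_mono)
      fix z assume z: "z \<in> Z"
      let ?m = "min (D T z) (D (insert j T) z)"
      have "?m \<ge> 0"
        using D[of T z] D[of "insert j T" z] that z by auto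
      then have "?m * (2 * \<Delta>) \<le> ?m * (e True z j + e False z j)"
        using gap[OF z \<open>j < m\<close>] by (intro mult_left_mono) auto
      also have "\<dots> = ?m * e False z j + ?m * e True z j"
        by (simp add: algebra_simps)
      also have "\<dots> \<le> D T z * e False z j + D (insert j T) z * e True z j"
        using e[OF z \<open>j < m\<close>] by (intro add_mono mult_right_mono) auto
      finally show "?m * (2 * \<Delta>) \<le> D T z * e False z j + D (insert j T) z * e True z j" .
    qed
    also have "\<dots> = F T j + F (insert j T) j"
      using that by (simp add: F_def sum.distrib subset_Diff_insert)
    finally show ?thesis .
  qed
  \<comment> \<open>The cube has \<open>m * 2 ^ (m - 1)\<close> edges, each contributing
    \<open>2 * \<Delta> * A\<close>; \<open>m = 0\<close> is split off because of the truncated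
    \<open>m - 1\<close>.\<close>
  have "(\<Sum>T\<in>Pow {..<m}. real m * \<Delta> * A) = (\<Sum>j<m. \<Sum>T\<in>Pow ({..<m} - {j}). 2 * \<Delta> * A)"
    by (cases m) (simp_all add: card_Pow)
  also have "\<dots> \<le> (\<Sum>j<m. \<Sum>T\<in>Pow ({..<m} - {j}). F T j + F (insert j T) j)"
    using F_pair by (intro sum_mono) auto
  also have "\<dots> = (\<Sum>j<m. \<Sum>T\<in>Pow {..<m}. F T j)"
    by (intro sum.cong refl sum_Pow_split[symmetric]) auto
  also have "\<dots> = (\<Sum>T\<in>Pow {..<m}. \<Sum>j<m. F T j)"
    by (rule sum.swap)
  finally have "\<not> (\<forall>T\<in>Pow {..<m}. (\<Sum>j<m. F T j) < real m * \<Delta> * A)"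
    using sum_strict_mono[of "Pow {..<m}" "\<lambda>T. \<Sum>j<m. F T j" "\<lambda>_. real m * \<Delta> * A"] by force
  then obtain T where "T \<subseteq> {..<m}" "(\<Sum>j<m. F T j) \<ge> real m * \<Delta> * A"
    by auto
  moreover have "(\<Sum>j<m. F T j) = (\<Sum>z\<in>Z. D T z * (\<Sum>j<m. e (j \<in> T) z j))"
    unfolding F_def by (subst sum.swap) (simp add: sum_distrib_left)
  ultimately show ?thesis
    by auto
qed

section \<open>Products of finite point measures\<close>

text \<open>It suffices to compare boxes \<open>Pi\<^sub>E I A\<close>, where a product of finite
  sums expands into a sum of products. Integrals over training sets thereby become finite
  sums.\<close>

lemma PiM_point_measure:
  fixes f :: "'a \<Rightarrow> real"
  assumes I: "finite I" and \<Omega>: "finite \<Omega>" and f: "\<And>x. x \<in> \<Omega> \<Longrightarrow> f x \<ge> 0"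
  shows "PiM I (\<lambda>_. point_measure \<Omega> f) = point_measure (I \<rightarrow>\<^sub>E \<Omega>) (\<lambda>z. \<Prod>i\<in>I. f (z i))"
proof -
  have "finite_measure (point_measure \<Omega> f)"
    using \<Omega> by (intro finite_measureI) (simp add: emeasure_point_measure_finite space_point_measure)
  then interpret product_sigma_finite "\<lambda>_. point_measure \<Omega> f"
    by (intro product_sigma_finite.intro finite_measure.sigma_finite_measure)
  have "point_measure (I \<rightarrow>\<^sub>E \<Omega>) (\<lambda>z. \<Prod>i\<in>I. f (z i)) = PiM I (\<lambda>_. point_measure \<Omega> f)"
  proof (rule PiM_eqI[OF I])
    have "sets (PiM I (\<lambda>_. point_measure \<Omega> f)) = sets (PiM I (\<lambda>_. count_space \<Omega>))"
      by (intro sets_PiM_cong) (simp_all add: sets_point_measure)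
    also have "\<dots> = sets (count_space (I \<rightarrow>\<^sub>E \<Omega>))"
      using I \<Omega> by (subst count_space_PiM_finite) (auto simp: countable_finite)
    finally show "sets (point_measure (I \<rightarrow>\<^sub>E \<Omega>) (\<lambda>z. \<Prod>i\<in>I. f (z i))) =
        sets (PiM I (\<lambda>_. point_measure \<Omega> f))"
      by (simp add: sets_point_measure)
  next
    fix A assume "\<And>i. i \<in> I \<Longrightarrow> A i \<in> sets (point_measure \<Omega> f)"
    then have A: "A i \<subseteq> \<Omega>" if "i \<in> I" for i
      using that by (auto simp: sets_point_measure)
    then have fin: "finite (A i)" if "i \<in> I" for i
      using that \<Omega> finite_subset by blast
    have "emeasure (point_measure (I \<rightarrow>\<^sub>E \<Omega>) (\<lambda>z. \<Prod>i\<in>I. f (z i))) (Pi\<^sub>E I A)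
        = (\<Sum>z\<in>Pi\<^sub>E I A. ennreal (\<Prod>i\<in>I. f (z i)))"
      using I \<Omega> A by (intro emeasure_point_measure_finite) (auto intro!: finite_PiE simp: PiE_iff)
    also have "\<dots> = (\<Sum>z\<in>Pi\<^sub>E I A. \<Prod>i\<in>I. ennreal (f (z i)))"
      using A f by (intro sum.cong refl prod_ennreal[symmetric]) (auto simp: PiE_iff)
    also have "\<dots> = (\<Prod>i\<in>I. \<Sum>x\<in>A i. ennreal (f x))"
      using I fin by (intro prod_sum_PiE[symmetric]) auto
    also have "\<dots> = (\<Prod>i\<in>I. emeasure (point_measure \<Omega> f) (A i))"
      using A \<Omega> by (intro prod.cong refl) (simp add: emeasure_point_measure_finite)
    finally show "emeasure (point_measure (I \<rightarrow>\<^sub>E \<Omega>) (\<lambda>z. \<Prod>i\<in>I. f (z i))) (Pi\<^sub>E I A)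
      = (\<Prod>i\<in>I. emeasure (point_measure \<Omega> f) (A i))" .
  qed
  then show ?thesis ..
qed

section \<open>Measurability and separation of points\<close>

lemma space_output_space [simp]: "space (output_space B) = {-B..B}"
  by (simp add: output_space_def space_restrict_space)

lemma space_data_space: "space (data_space M B) = space M \<times> {-B..B}"
  by (simp add: data_space_def space_pair_measure)

lemma measurable_output_space_borel: "f \<in> measurable N (output_space B) \<Longrightarrow> f \<in> borel_measurable N"
  by (simp add: output_space_def measurable_restrict_space2_iff)

lemma prediction_functions_range:
  "g \<in> prediction_functions M B \<Longrightarrow> x \<in> space M \<Longrightarrow> \<bar>g x\<bar> \<le> B"
  using measurable_space[of g M "output_space B" x] by (force simp: prediction_functions_def)

lemma measurable_loss:
  assumes "g \<in> prediction_functions M B"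
  shows "(\<lambda>(x, y). loss q y (g x)) \<in> borel_measurable (data_space M B)"
proof -
  have [measurable]: "g \<in> borel_measurable M"
    using assms by (auto simp: prediction_functions_def intro: measurable_output_space_borel)
  have [measurable]: "snd \<in> borel_measurable (data_space M B)"
    unfolding data_space_def by (intro measurable_output_space_borel[where B=B] measurable_snd)
  have [measurable]: "fst \<in> measurable (data_space M B) M"
    by (simp add: data_space_def)
  show ?thesis
    unfolding loss_def case_prod_beta by measurable
qed

lemma estimator_measurable:
  assumes "estimator M B n ghat" "x \<in> space M"
  shows "(\<lambda>z. ghat z x) \<in> borel_measurable (training_space M B n)"
proof -
  have "(\<lambda>z. (z, x)) \<in> measurable (training_space M B n) (training_space M B n \<Otimes>\<^sub>M M)"
    using assms(2) by simp
  from measurable_compose[OF this, of "\<lambda>(z, x). ghat z x" "output_space B"] assms(1)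
  show ?thesis
    by (intro measurable_output_space_borel[where B=B]) (simp add: estimator_def)
qed

text \<open>For each \<open>x \<in> T\<close>, the sets separating it from the finitely many
  \<open>y \<in> S - T\<close> are intersected; the union over \<open>x\<close> is then
  taken.\<close>

lemma separating_set:
  assumes sep: "separates_points M" and S: "finite S" "S \<subseteq> space M" and "T \<subseteq> S"
  shows "\<exists>A\<in>sets M. A \<inter> S = T"
proof -
  have "\<exists>A\<in>sets M. x \<in> A \<and> y \<notin> A" if "x \<in> T" "y \<in> S - T" for x y
  proof -
    have "x \<in> space M" "y \<in> space M" "x \<noteq> y"
      using that S(2) \<open>T \<subseteq> S\<close> by auto
    then show ?thesis
      using sep by (simp add: separates_points_def)
  qed
  then have "\<forall>x\<in>T. \<forall>y\<in>S - T. \<exists>A. A \<in> sets M \<and> x \<in> A \<and> y \<notin> A"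
    unfolding Bex_def by (intro ballI)
  then obtain A where A: "\<And>x y. x \<in> T \<Longrightarrow> y \<in> S - T \<Longrightarrow> A x y \<in> sets M \<and> x \<in> A x y \<and> y \<notin> A x y"
    by metis
  have fin: "finite T" "finite (S - T)"
    using S \<open>T \<subseteq> S\<close> finite_subset by auto
  \<comment> \<open>The factor \<open>space M\<close> matters when \<open>S - T\<close> is empty,
    since the empty intersection is \<open>UNIV\<close>.\<close>
  let ?A = "\<Union>x\<in>T. space M \<inter> (\<Inter>y\<in>S - T. A x y)"
  have "?A \<in> sets M"
  proof (intro sets.finite_UN fin)
    fix x assume "x \<in> T"
    then show "space M \<inter> (\<Inter>y\<in>S - T. A x y) \<in> sets M"
    proof (cases "S - T = {}")
      case True
      show ?thesis
        unfolding True by simp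
    next
      case False
      then show ?thesis
        using A \<open>x \<in> T\<close> fin(2) by (intro sets.Int sets.top sets.finite_INT) auto
    qed
  qed
  moreover have "?A \<inter> S = T"
    using A S \<open>T \<subseteq> S\<close> by blast
  ultimately show ?thesis
    by blast
qed

text \<open>The constants alone are infinitely many. This allows a set of predictors to be filled up
  to exactly \<open>d\<close> elements.\<close>

lemma infinite_prediction_functions:
  assumes "B > 0" "x \<in> space M"
  shows "infinite (prediction_functions M B)"
proof
  assume "finite (prediction_functions M B)"
  moreover have "(\<lambda>c. restrict (\<lambda>_. c) (space M)) ` {-B..B} \<subseteq> prediction_functions M B"
    by (auto simp: prediction_functions_def measurable_restrict_space2_iff cong: measurable_cong)
  moreover have "inj_on (\<lambda>c. restrict (\<lambda>_. c) (space M)) {-B..B}"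
    using assms(2) by (auto simp: inj_on_def dest!: fun_cong[where x=x])
  ultimately have "finite {-B..B}"
    by (meson finite_subset finite_imageD)
  then show False
    using assms(1) by (simp add: infinite_Icc)
qed

text \<open>The conclusion of the theorem with the bound left free as \<open>c\<close>, so that two
  constructions can be treated alike.\<close>

definition minimax_excess_ge :: "'x measure \<Rightarrow> real \<Rightarrow> real \<Rightarrow> nat \<Rightarrow> nat \<Rightarrow> real \<Rightarrow> bool"
  where "minimax_excess_ge M B q n d c \<longleftrightarrow>
    (\<exists>G. G \<subseteq> prediction_functions M B \<and> finite G \<and> card G = d \<and>
      (\<forall>ghat. estimator M B n ghat \<longrightarrow>
        (\<exists>P. data_distribution M B P \<and> expected_risk q n P ghat - Min (risk q P ` G) \<ge> c)))"

lemma minimax_excess_ge_mono: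
  assumes "minimax_excess_ge M B q n d c" "c' \<le> c"
  shows "minimax_excess_ge M B q n d c'"
proof -
  obtain G where G: "G \<subseteq> prediction_functions M B" "finite G" "card G = d" and
    lower: "\<forall>ghat. estimator M B n ghat \<longrightarrow>
      (\<exists>P. data_distribution M B P \<and> expected_risk q n P ghat - Min (risk q P ` G) \<ge> c)"
    using assms(1) unfolding minimax_excess_ge_def by (elim exE conjE)
  have "\<exists>P. data_distribution M B P \<and> expected_risk q n P ghat - Min (risk q P ` G) \<ge> c'"
    if "estimator M B n ghat" for ghat
    using lower that order.trans[OF assms(2)] by meson
  with G show ?thesis
    unfolding minimax_excess_ge_def by (intro exI[of _ G] conjI allI impI)
qed

section \<open>The hypercube of distributions\<close>

text \<open>\<open>X m\<close> is the further point carrying the remaining mass.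
  \<open>stationary\<close> is the first-order condition that makes \<open>b\<close> optimal where
  the positive output has probability \<open>p\<close>.\<close>

locale hypercube =
  fixes M :: "'x measure" and B q :: real and m :: nat and X :: "nat \<Rightarrow> 'x" and w p b :: real
  assumes B: "B > 0" and q: "q \<ge> 1"
    and X: "\<And>j. j \<le> m \<Longrightarrow> X j \<in> space M"
    and w: "w \<ge> 0" "real m * w \<le> 1"
    and p: "0 \<le> p" "p \<le> 1"
    and b: "\<bar>b\<bar> \<le> B"
    and stationary: "p * (B - b) powr (q - 1) = (1 - p) * (B + b) powr (q - 1)"
begin

text \<open>A data point is coded by the index of its input and the sign of its output; transport
  from this finite set by \<open>datum\<close> turns expectations into finite sums.\<close>

definition points :: "(nat \<times> bool) set"
  where "points = {..m} \<times> UNIV"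

definition label :: "bool \<Rightarrow> real"
  where "label s = (if s then B else - B)"

definition datum :: "nat \<times> bool \<Rightarrow> 'x \<times> real"
  where "datum = (\<lambda>(j, s). (X j, label s))"

definition mass :: "nat \<Rightarrow> real"
  where "mass j = (if j < m then w else 1 - real m * w)"

text \<open>\<open>T\<close> is a vertex of the cube: the indices where the positive sign has
  probability \<open>p\<close>. For \<open>T \<subseteq> {..<m}\<close> it is the negative sign that
  has probability \<open>p\<close> at the index \<open>m\<close>.\<close>

definition weight :: "nat set \<Rightarrow> nat \<times> bool \<Rightarrow> real"
  where "weight T = (\<lambda>(j, s). mass j * (if s = (j \<in> T) then p else 1 - p))"

definition law :: "nat set \<Rightarrow> ('x \<times> real) measure"
  where "law T = distr (point_measure points (weight T)) (data_space M B) datum"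

definition samples :: "nat \<Rightarrow> (nat \<Rightarrow> nat \<times> bool) set"
  where "samples n = {..<n} \<rightarrow>\<^sub>E points"

definition likelihood :: "nat \<Rightarrow> nat set \<Rightarrow> (nat \<Rightarrow> nat \<times> bool) \<Rightarrow> real"
  where "likelihood n T z = (\<Prod>i<n. weight T (z i))"

definition cond_risk :: "bool \<Rightarrow> real \<Rightarrow> real"
  where "cond_risk s y = p * loss q (label s) y + (1 - p) * loss q (- label s) y"

text \<open>The least conditional risk, attained at \<open>b\<close> or \<open>- b\<close>. It is
  the same at every point, hence also the optimal risk at every vertex.\<close>

definition bayes_risk :: real
  where "bayes_risk = p * (B - b) powr q + (1 - p) * (B + b) powr q"

lemma finite_points [simp]: "finite points"
  by (simp add: points_def)

lemma finite_samples [simp]: "finite (samples n)"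
  by (simp add: samples_def finite_PiE)

lemma mass_nonneg: "mass j \<ge> 0"
  using w by (simp add: mass_def)

lemma sum_mass: "(\<Sum>j\<le>m. mass j) = 1"
proof -
  have "(\<Sum>j<m. mass j) = real m * w"
    by (simp add: mass_def)
  then show ?thesis
    by (simp add: lessThan_Suc_atMost[symmetric] mass_def)
qed

lemma sum_points: "(\<Sum>\<omega>\<in>points. f \<omega>) = (\<Sum>j\<le>m. f (j, True) + f (j, False))"
proof -
  have "(\<Sum>j\<le>m. \<Sum>s\<in>UNIV. f (j, s)) = (\<Sum>\<omega>\<in>points. f \<omega>)"
    by (simp add: points_def sum.cartesian_product)
  then show ?thesis
    by (simp add: UNIV_bool add.commute)
qed

lemma weight_nonneg: "weight T \<omega> \<ge> 0"
  using p mass_nonneg by (auto simp: weight_def split: prod.splits)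

lemma sum_weight: "sum (weight T) points = 1"
proof -
  have "sum (weight T) points = (\<Sum>j\<le>m. mass j)"
    unfolding sum_points by (intro sum.cong) (auto simp: weight_def algebra_simps)
  then show ?thesis
    by (simp add: sum_mass)
qed

lemma likelihood_nonneg: "likelihood n T z \<ge> 0"
  by (simp add: likelihood_def prod_nonneg weight_nonneg)

lemma sum_likelihood: "sum (likelihood n T) (samples n) = 1"
  using prod_sum_PiE[of "{..<n}" "\<lambda>_. points" "\<lambda>_. weight T"]
  by (simp add: likelihood_def samples_def sum_weight)

lemma prob_space_weight: "prob_space (point_measure points (weight T))"
  by (intro prob_spaceI)
    (simp add: space_point_measure emeasure_point_measure_finite sum_ennreal weight_nonneg sum_weight)

lemma datum_measurable: "datum \<in> measurable (point_measure points (weight T)) (data_space M B)"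
  using X B by (auto simp: space_data_space datum_def points_def label_def)

lemma data_distribution_law: "data_distribution M B (law T)"
  unfolding data_distribution_def law_def
  using prob_space.prob_space_distr[OF prob_space_weight datum_measurable] by simp

lemma risk_law:
  assumes "g \<in> prediction_functions M B"
  shows "risk q (law T) g = (\<Sum>j\<le>m. mass j * cond_risk (j \<in> T) (g (X j)))"
proof -
  have "risk q (law T) g = (\<Sum>\<omega>\<in>points. weight T \<omega> * (case datum \<omega> of (x, y) \<Rightarrow> loss q y (g x)))"
    unfolding risk_def law_def
    by (subst integral_distr[OF datum_measurable measurable_loss[OF assms]])
      (simp add: lebesgue_integral_point_measure_finite weight_nonneg)
  also have "\<dots> = (\<Sum>j\<le>m. mass j * cond_risk (j \<in> T) (g (X j)))"
    unfolding sum_points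
    by (intro sum.cong) (auto simp: weight_def datum_def cond_risk_def label_def algebra_simps)
  finally show ?thesis .
qed

text \<open>Products commute with push-forwards, and the product of the finite laws is a finite law
  with weights \<open>likelihood\<close>.\<close>

lemma expected_risk_law:
  assumes ghat: "estimator M B n ghat"
  shows "expected_risk q n (law T) ghat
    = (\<Sum>z\<in>samples n. likelihood n T z * risk q (law T) (ghat (compose {..<n} datum z)))"
proof -
  let ?N = "point_measure points (weight T)"
  let ?D = "data_space M B"
  have D: "prob_space (law T)" "sets (law T) = sets ?D"
    using data_distribution_law by (auto simp: data_distribution_def)
  have datum: "datum \<in> measurable ?N (law T)"
    using datum_measurable measurable_cong_sets[OF refl D(2)] by blast
  have law_eq: "distr ?N (law T) datum = law T"
    using D(2) by (simp add: law_def cong: distr_cong)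
  have sets_eq: "sets (PiM {..<n} (\<lambda>_. law T)) = sets (training_space M B n)"
    unfolding training_space_def by (intro sets_PiM_cong refl D(2))
  have space_eq: "space (PiM {..<n} (\<lambda>_. law T)) = space (training_space M B n)"
    by (rule sets_eq_imp_space_eq[OF sets_eq])
  have pred: "ghat z \<in> prediction_functions M B" if "z \<in> space (training_space M B n)" for z
    using that ghat by (simp add: estimator_def)
  \<comment> \<open>By \<open>risk_law\<close> the risk depends on the fitted function only through
    its values at the \<open>X j\<close>, each measurable in the training set.\<close>
  have meas: "(\<lambda>z. risk q (law T) (ghat z)) \<in> borel_measurable (PiM {..<n} (\<lambda>_. law T))"
  proof -
    have [measurable]: "(\<lambda>z. ghat z (X j)) \<in> borel_measurable (training_space M B n)" if "j \<le> m" for j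
      using estimator_measurable[OF ghat X[OF that]] .
    have "(\<lambda>z. \<Sum>j\<le>m. mass j * cond_risk (j \<in> T) (ghat z (X j)))
        \<in> borel_measurable (training_space M B n)"
      unfolding cond_risk_def loss_def by measurable
    then have "(\<lambda>z. risk q (law T) (ghat z)) \<in> borel_measurable (training_space M B n)"
      by (subst measurable_cong[OF risk_law[OF pred]])
    then show ?thesis
      using measurable_cong_sets[OF sets_eq refl] by blast
  qed
  have comp: "compose {..<n} datum \<in> measurable (PiM {..<n} (\<lambda>_. ?N)) (PiM {..<n} (\<lambda>_. law T))"
    unfolding compose_def
    by (intro measurable_restrict measurable_compose[OF _ datum] measurable_component_singleton)
  have "PiM {..<n} (\<lambda>_. law T) = distr (PiM {..<n} (\<lambda>_. ?N)) (PiM {..<n} (\<lambda>_. law T)) (compose {..<n} datum)"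
    using distr_PiM_finite_prob_space'[OF finite_lessThan prob_space_weight D(1) datum]
    unfolding law_eq by (rule sym)
  then have "expected_risk q n (law T) ghat
    = (\<integral>z. risk q (law T) (ghat (compose {..<n} datum z)) \<partial>PiM {..<n} (\<lambda>_. ?N))"
    unfolding expected_risk_def by (metis integral_distr[OF comp meas])
  also have "PiM {..<n} (\<lambda>_. ?N) = point_measure (samples n) (likelihood n T)"
    using PiM_point_measure[of "{..<n}" points "weight T"]
    by (simp add: samples_def likelihood_def[abs_def] weight_nonneg)
  finally show ?thesis
    by (simp add: lebesgue_integral_point_measure_finite likelihood_nonneg)
qed


section \<open>Conditional risks and expected regret\<close>

lemma cond_risk_True:
  assumes "\<bar>y\<bar> \<le> B"
  shows "cond_risk True y = p * (B - y) powr q + (1 - p) * (B + y) powr q"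
proof -
  have "\<bar>B - y\<bar> = B - y" "\<bar>- B - y\<bar> = B + y"
    using assms by auto
  then show ?thesis
    by (simp add: cond_risk_def label_def loss_def)
qed

lemma cond_risk_False: "cond_risk False y = cond_risk True (- y)"
  by (simp add: cond_risk_def label_def loss_def add.commute abs_minus_commute)

lemma bayes_risk_le:
  assumes "\<bar>y\<bar> \<le> B"
  shows "bayes_risk \<le> cond_risk s y"
proof -
  have "bayes_risk \<le> cond_risk True y" if "\<bar>y\<bar> \<le> B" for y
    unfolding bayes_risk_def cond_risk_True[OF that] using q p b that stationary
    by (rule weighted_powr_ge)
  then show ?thesis
    using assms by (cases s) (simp_all add: cond_risk_False)
qed

lemma cond_risk_eq_bayes_risk: "cond_risk s (if s then b else - b) = bayes_risk"
  using b by (simp add: cond_risk_False cond_risk_True bayes_risk_def)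

text \<open>The weights \<open>p\<close> and \<open>1 - p\<close> trade places between the signs, so
  the sum is \<open>(B - y) powr q + (B + y) powr q\<close>.\<close>

lemma sum_cond_risk_ge:
  assumes "\<bar>y\<bar> \<le> B"
  shows "2 * B powr q \<le> cond_risk True y + cond_risk False y"
  using sum_powr_ge[OF q assms] assms by (simp add: cond_risk_False cond_risk_True algebra_simps)

lemma bayes_risk_le_powr: "bayes_risk \<le> B powr q"
  using bayes_risk_le[of 0 True] B by (simp add: cond_risk_True algebra_simps)

text \<open>Assouad's lemma with \<open>e\<close> the regret at \<open>X j\<close> and
  \<open>\<Delta> = B powr q - bayes_risk\<close>.\<close>

lemma expected_excess_risk:
  assumes ghat: "estimator M B n ghat"
    and affinity: "\<And>T j. T \<subseteq> {..<m} - {j} \<Longrightarrow> j < m \<Longrightarrow>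
      A \<le> (\<Sum>z\<in>samples n. min (likelihood n T z) (likelihood n (insert j T) z))"
  shows "\<exists>T\<subseteq>{..<m}. expected_risk q n (law T) ghat - bayes_risk
    \<ge> real m * w * (B powr q - bayes_risk) * A"
proof -
  define e where "e s z j = cond_risk s (ghat (compose {..<n} datum z) (X j)) - bayes_risk" for s z j
  have train: "compose {..<n} datum z \<in> space (training_space M B n)" if "z \<in> samples n" for z
    using that measurable_space[OF datum_measurable]
    by (auto simp: training_space_def space_PiM samples_def PiE_iff compose_def space_point_measure)
  have pred: "ghat (compose {..<n} datum z) \<in> prediction_functions M B" if "z \<in> samples n" for z
    using ghat train[OF that] by (simp add: estimator_def)
  have range: "\<bar>ghat (compose {..<n} datum z) (X j)\<bar> \<le> B" if "z \<in> samples n" "j \<le> m" for z j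
    using prediction_functions_range[OF pred[OF that(1)] X[OF that(2)]] .
  have e: "e s z j \<ge> 0" if "z \<in> samples n" "j \<le> m" for s z j
    using bayes_risk_le[OF range[OF that]] by (simp add: e_def)
  obtain T where T: "T \<subseteq> {..<m}" and
    "(\<Sum>z\<in>samples n. likelihood n T z * (\<Sum>j<m. e (j \<in> T) z j)) \<ge> real m * (B powr q - bayes_risk) * A"
  proof (atomize_elim, rule assouad)
    show "e True z j + e False z j \<ge> 2 * (B powr q - bayes_risk)" if "z \<in> samples n" "j < m" for z j
      using sum_cond_risk_ge[OF range[of z j]] that by (simp add: e_def)
  qed (use affinity e bayes_risk_le_powr in \<open>auto simp: likelihood_nonneg\<close>)
  then have "w * (real m * (B powr q - bayes_risk) * A)
      \<le> w * (\<Sum>z\<in>samples n. likelihood n T z * (\<Sum>j<m. e (j \<in> T) z j))"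
    using w by (intro mult_left_mono) auto
  also have "\<dots> = (\<Sum>z\<in>samples n. likelihood n T z * (\<Sum>j<m. mass j * e (j \<in> T) z j))"
    by (simp add: mass_def sum_distrib_left mult.left_commute)
  \<comment> \<open>The regret at the further point \<open>X m\<close> is nonnegative, so its term
    may be added.\<close>
  also have "\<dots> \<le> (\<Sum>z\<in>samples n. likelihood n T z * (\<Sum>j\<le>m. mass j * e (j \<in> T) z j))"
    using e by (intro sum_mono mult_left_mono sum_mono2) (auto simp: likelihood_nonneg mass_nonneg)
  also have "\<dots> = (\<Sum>z\<in>samples n. likelihood n T z
      * (risk q (law T) (ghat (compose {..<n} datum z)) - bayes_risk))"
    by (intro sum.cong refl)
      (simp add: e_def risk_law pred right_diff_distrib sum_subtractf sum_distrib_right[symmetric] sum_mass)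
  also have "\<dots> = expected_risk q n (law T) ghat - bayes_risk"
    by (simp add: expected_risk_law[OF ghat] right_diff_distrib sum_subtractf
        sum_distrib_right[symmetric] sum_likelihood)
  finally show ?thesis
    using T by (intro exI[of _ T]) (simp add: algebra_simps)
qed

section \<open>Overlap of neighbouring vertices\<close>

text \<open>Neighbouring laws agree except at the index \<open>j\<close>, where a fraction
  \<open>c\<close> of the mass is shared: 0 for deterministic outputs,
  \<open>2 * sqrt (p * (1 - p))\<close> for the Bhattacharyya coefficient.\<close>

lemma sum_mass_scaled:
  assumes "j < m"
  shows "(\<Sum>i\<le>m. if i = j then c * mass i else mass i) = 1 - w * (1 - c)"
proof -
  have "(\<Sum>i\<le>m. if i = j then c * mass i else mass i)
    = (\<Sum>i\<le>m. mass i + (if i = j then (c - 1) * mass i else 0))"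
    by (intro sum.cong) (auto simp: algebra_simps)
  also have "\<dots> = 1 - w * (1 - c)"
    using assms by (simp add: sum.distrib sum_mass) (simp add: mass_def algebra_simps)
  finally show ?thesis .
qed

lemma affinity_min:
  assumes "T \<subseteq> {..<m} - {j}" "j < m" "p = 1"
  shows "(1 - w) ^ n \<le> (\<Sum>z\<in>samples n. min (likelihood n T z) (likelihood n (insert j T) z))"
proof -
  have "(\<Sum>\<omega>\<in>points. min (weight T \<omega>) (weight (insert j T) \<omega>))
    = (\<Sum>i\<le>m. if i = j then 0 * mass i else mass i)"
    unfolding sum_points
  proof (intro sum.cong refl)
    fix i
    show "min (weight T (i, True)) (weight (insert j T) (i, True))
      + min (weight T (i, False)) (weight (insert j T) (i, False))
      = (if i = j then 0 * mass i else mass i)"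
      unfolding weight_def using assms(1,3) mass_nonneg[of i]
      by (cases "i = j") (simp_all add: subset_Diff_insert)
  qed
  also have "\<dots> = 1 - w"
    using sum_mass_scaled[OF assms(2)] by simp
  finally show ?thesis
    using power_sum_min_le[of points "weight T" "weight (insert j T)" n]
    by (simp add: weight_nonneg likelihood_def samples_def)
qed

text \<open>At the index \<open>j\<close> the two laws swap \<open>p\<close> and
  \<open>1 - p\<close>, so each sign contributes \<open>sqrt (p * (1 - p))\<close> times the
  mass.\<close>

lemma affinity_sqrt:
  assumes "T \<subseteq> {..<m} - {j}" "j < m"
  shows "((1 - w * (1 - 2 * sqrt (p * (1 - p)))) ^ n)\<^sup>2 / 2
    \<le> (\<Sum>z\<in>samples n. min (likelihood n T z) (likelihood n (insert j T) z))"
proof -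
  have sqrt_eq: "sqrt ((a * x) * (a * y)) = a * sqrt (x * y)" if "a \<ge> 0" for a x y :: real
  proof -
    have "(a * x) * (a * y) = a\<^sup>2 * (x * y)"
      by (simp add: power2_eq_square mult_ac)
    then show ?thesis
      using that by (simp only: real_sqrt_mult real_sqrt_abs abs_of_nonneg)
  qed
  have "(\<Sum>\<omega>\<in>points. sqrt (weight T \<omega> * weight (insert j T) \<omega>))
    = (\<Sum>i\<le>m. if i = j then 2 * sqrt (p * (1 - p)) * mass i else mass i)"
    unfolding sum_points
  proof (intro sum.cong refl)
    fix i
    show "sqrt (weight T (i, True) * weight (insert j T) (i, True))
      + sqrt (weight T (i, False) * weight (insert j T) (i, False))
      = (if i = j then 2 * sqrt (p * (1 - p)) * mass i else mass i)"
    proof (cases "i = j")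
      case True
      then have "i \<notin> T"
        using assms(1) by auto
      then have "weight T (j, True) = mass j * (1 - p)" "weight (insert j T) (j, True) = mass j * p"
        "weight T (j, False) = mass j * p" "weight (insert j T) (j, False) = mass j * (1 - p)"
        using True by (simp_all add: weight_def)
      moreover have "sqrt ((1 - p) * p) = sqrt (p * (1 - p))"
        by (simp only: mult.commute)
      ultimately show ?thesis
        unfolding True by (simp only: sqrt_eq[OF mass_nonneg]) simp
    next
      case False
      have "mass i * p + mass i * (1 - p) = mass i"
        by (simp add: algebra_simps)
      with False p show ?thesis
        unfolding weight_def by (simp add: mass_nonneg add.commute)
    qed
  qed
  also have "\<dots> = 1 - w * (1 - 2 * sqrt (p * (1 - p)))"
    by (rule sum_mass_scaled[OF assms(2)])
  finally show ?thesis
    using power_sum_sqrt_le[of points "weight T" "weight (insert j T)" n]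
    by (simp add: weight_nonneg sum_weight likelihood_def samples_def)
qed

section \<open>Optimal predictors and the bound for one cube\<close>

lemma vertex_function:
  assumes "separates_points M" "inj_on X {..m}"
  shows "\<exists>g\<in>prediction_functions M B. \<forall>j\<le>m. g (X j) = (if j \<in> T then b else - b)"
proof -
  obtain S where S: "S \<in> sets M" "S \<inter> X ` {..m} = X ` (T \<inter> {..m})"
    using separating_set[OF assms(1), of "X ` {..m}" "X ` (T \<inter> {..m})"] X by blast
  have mem: "X j \<in> S \<longleftrightarrow> j \<in> T" if "j \<le> m" for j
  proof -
    have "X j \<in> S \<longleftrightarrow> X j \<in> X ` (T \<inter> {..m})"
      using S(2) that by blast
    also have "\<dots> \<longleftrightarrow> j \<in> T"
      using inj_on_image_mem_iff[OF assms(2), of j "T \<inter> {..m}"] that by auto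
    finally show ?thesis .
  qed
  let ?g = "restrict (\<lambda>x. if x \<in> S then b else - b) (space M)"
  have "(\<lambda>x. if x \<in> S then b else - b) \<in> measurable M (output_space B)"
    using S(1) b unfolding output_space_def by (intro measurable_restrict_space2 measurable_If_set) auto
  then have "?g \<in> prediction_functions M B"
    by (simp add: prediction_functions_def cong: measurable_cong)
  moreover have "?g (X j) = (if j \<in> T then b else - b)" if "j \<le> m" for j
    using X[OF that] mem[OF that] by simp
  ultimately show ?thesis
    by blast
qed

text \<open>The predictors optimal at some vertex number at most \<open>2 ^ m\<close>. Filling up to
  \<open>d\<close> functions can only lower the minimum over the set, hence only raise the
  excess.\<close>

lemma minimax_lower_bound:
  assumes "separates_points M" "inj_on X {..m}" "2 ^ m \<le> d"
    and affinity: "\<And>T j. T \<subseteq> {..<m} - {j} \<Longrightarrow> j < m \<Longrightarrow>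
      A \<le> (\<Sum>z\<in>samples n. min (likelihood n T z) (likelihood n (insert j T) z))"
  shows "minimax_excess_ge M B q n d (real m * w * (B powr q - bayes_risk) * A)"
proof -
  have "\<forall>T. \<exists>g. g \<in> prediction_functions M B \<and> (\<forall>j\<le>m. g (X j) = (if j \<in> T then b else - b))"
    using vertex_function[OF assms(1,2)] unfolding Bex_def by (rule allI)
  from choice[OF this] obtain g where g: "\<And>T. g T \<in> prediction_functions M B"
      "\<And>T j. j \<le> m \<Longrightarrow> g T (X j) = (if j \<in> T then b else - b)"
    by auto
  define G0 where "G0 = g ` Pow {..<m}"
  have G0: "finite G0" "card G0 \<le> d" "G0 \<subseteq> prediction_functions M B"
  proof -
    show "finite G0" "G0 \<subseteq> prediction_functions M B"
      using g(1) by (auto simp: G0_def)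
    have "card G0 \<le> 2 ^ m"
      using card_image_le[of "Pow {..<m}" g] by (simp add: G0_def card_Pow)
    then show "card G0 \<le> d"
      using assms(3) by (rule order.trans)
  qed
  have "infinite (prediction_functions M B - G0)"
    by (rule Diff_infinite_finite[OF G0(1) infinite_prediction_functions[OF B X[of 0]]]) simp
  then obtain G1 where G1: "finite G1" "card G1 = d - card G0" "G1 \<subseteq> prediction_functions M B - G0"
    using infinite_arbitrarily_large[of _ "d - card G0"] by metis
  have "G0 \<inter> G1 = {}"
    using G1(3) by blast
  then have "finite (G0 \<union> G1)" "card (G0 \<union> G1) = d" "G0 \<union> G1 \<subseteq> prediction_functions M B"
    using G0 G1 by (auto simp: card_Un_disjoint)
  moreover have "\<exists>P. data_distribution M B P \<and>
      expected_risk q n P ghat - Min (risk q P ` (G0 \<union> G1)) \<ge> real m * w * (B powr q - bayes_risk) * A"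
    if ghat: "estimator M B n ghat" for ghat
  proof -
    have "\<exists>T\<subseteq>{..<m}. expected_risk q n (law T) ghat - bayes_risk
        \<ge> real m * w * (B powr q - bayes_risk) * A"
      using ghat by (rule expected_excess_risk) (rule affinity)
    then obtain T where T: "T \<subseteq> {..<m}"
      "expected_risk q n (law T) ghat - bayes_risk \<ge> real m * w * (B powr q - bayes_risk) * A"
      by blast
    have "risk q (law T) (g T) = (\<Sum>j\<le>m. mass j * bayes_risk)"
      unfolding risk_law[OF g(1)] by (intro sum.cong) (simp_all add: g(2) cond_risk_eq_bayes_risk)
    then have "risk q (law T) (g T) = bayes_risk"
      by (simp add: sum_distrib_right[symmetric] sum_mass)
    moreover have "Min (risk q (law T) ` (G0 \<union> G1)) \<le> risk q (law T) (g T)"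
      using T(1) G0(1) G1(1) by (intro Min_le imageI) (simp_all add: G0_def)
    ultimately show ?thesis
      using T(2) by (intro exI[of _ "law T"] conjI data_distribution_law) linarith
  qed
  ultimately show ?thesis
    unfolding minimax_excess_ge_def by (intro exI[of _ "G0 \<union> G1"] conjI allI impI)
qed

end

section \<open>Deterministic outputs\<close>

lemma deterministic_lower_bound:
  fixes M :: "'x measure" and B q :: real and n k d :: nat and X :: "nat \<Rightarrow> 'x"
  assumes "B > 0" "q > 1" "separates_points M"
    and X: "\<And>j. j \<le> k \<Longrightarrow> X j \<in> space M" and inj: "inj_on X {..k}" and d: "2 ^ k \<le> d"
  shows "minimax_excess_ge M B q n d (exp (- 1) * B powr q * min (real k / (real n + 1)) 1)"
proof -
  \<comment> \<open>Capping the dimension at \<open>n + 1\<close> keeps the mass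
    \<open>m * w\<close> at most 1 and yields exactly the truncation in the bound.\<close>
  define m where "m = min k (n + 1)"
  define w where "w = 1 / (real n + 1)"
  have m: "m \<le> k" "real m * w = min (real k / (real n + 1)) 1"
    by (cases "k \<le> n + 1"; simp add: m_def w_def min_def)+
  \<comment> \<open>With \<open>p = 1\<close> and \<open>b = B\<close> both sides of
    \<open>stationary\<close> are 0.\<close>
  interpret H: hypercube M B q m X w 1 B
    using assms m by unfold_locales (auto simp: w_def)
  have bayes: "H.bayes_risk = 0"
    using \<open>q > 1\<close> by (simp add: H.bayes_risk_def)
  have "2 ^ m \<le> d"
    using m(1) d by (meson order.trans one_le_numeral power_increasing)
  moreover have "inj_on X {..m}"
    using inj m(1) by (auto intro: inj_on_subset)
  ultimately have lower: "minimax_excess_ge M B q n d (real m * w * (B powr q - H.bayes_risk) * (1 - w) ^ n)"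
    using H.affinity_min by (intro H.minimax_lower_bound[OF assms(3)]) auto
  have "exp (- 1) * B powr q * min (real k / (real n + 1)) 1
      \<le> real m * w * (B powr q - H.bayes_risk) * (1 - w) ^ n"
  proof -
    have "(B powr q * (real m * w)) * exp (- 1) \<le> (B powr q * (real m * w)) * (1 - w) ^ n"
      using exp_minus_1_le_power[of n] unfolding w_def[symmetric]
      by (intro mult_left_mono) (simp_all add: w_def)
    then show ?thesis
      unfolding m(2)[symmetric] bayes diff_zero by (simp only: mult_ac)
  qed
  with lower show ?thesis
    by (rule minimax_excess_ge_mono)
qed

section \<open>Noisy outputs for \<open>q\<close> close to 1\<close>

text \<open>The left side is the square of \<open>exp x - exp (- x)\<close>, which is at most
  \<open>21 / 10 * x\<close>; and \<open>(21 / 10)\<^sup>2 = 4.41\<close> is below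
  \<open>24 / 5\<close>.\<close>

lemma exp_sum_bound:
  fixes x :: real
  assumes "0 \<le> x" "x \<le> 1 / 10"
  shows "exp (2 * x) + exp (- (2 * x)) - 2 \<le> 24 / 5 * x\<^sup>2"
proof -
  have "exp x \<le> 1 + x + x\<^sup>2"
    using exp_bound[of x] assms by auto
  moreover have "exp (- x) \<ge> 1 - x"
    using exp_ge_add_one_self[of "- x"] by simp
  moreover have "x\<^sup>2 \<le> x / 10"
    using assms mult_left_mono[of x "1 / 10" x] by (simp add: power2_eq_square)
  ultimately have "exp x - exp (- x) \<le> 21 / 10 * x"
    by linarith
  moreover have "exp x - exp (- x) \<ge> 0"
    using assms by simp
  ultimately have "(exp x - exp (- x))\<^sup>2 \<le> (21 / 10 * x)\<^sup>2"
    by (intro power_mono)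
  moreover have "(exp x - exp (- x))\<^sup>2 = exp (2 * x) + exp (- (2 * x)) - 2"
    by (simp add: power2_eq_square algebra_simps exp_add[symmetric])
  ultimately show ?thesis
    by (simp add: power_mult_distrib power2_eq_square)
       (smt (verit) zero_le_square)
qed

text \<open>The hypothesis on \<open>k\<close> says that \<open>k\<close> points of mass
  \<open>1 / (4 * n * (q - 1)\<^sup>2)\<close> have total mass at most 1.\<close>

lemma noisy_lower_bound:
  fixes M :: "'x measure" and B q :: real and n k d :: nat and X :: "nat \<Rightarrow> 'x"
  assumes "B > 0" "n \<ge> 1" "separates_points M"
    and X: "\<And>j. j \<le> k \<Longrightarrow> X j \<in> space M" and inj: "inj_on X {..k}" and d: "2 ^ k \<le> d"
    and q: "1 < q" "q \<le> 11 / 10" and k: "real k \<le> 4 * real n * (q - 1)\<^sup>2"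
  shows "minimax_excess_ge M B q n d (q / (90 * (q - 1)) * B powr q * (real k / (real n + 1)))"
proof -
  define \<epsilon> where "\<epsilon> = q - 1"
  have \<epsilon>: "0 < \<epsilon>" "\<epsilon> \<le> 1 / 10" "q = 1 + \<epsilon>"
    using q by (auto simp: \<epsilon>_def)
  \<comment> \<open>\<open>E\<close> is \<open>2 * cosh (2 * \<epsilon>)\<close> and
    \<open>C\<close> is \<open>2 * cosh 2\<close>. With \<open>D = B / cosh 2\<close>,
    \<open>B - b\<close> and \<open>B + b\<close> are \<open>D * exp (- 2)\<close> and
    \<open>D * exp 2\<close>, so both sides of \<open>stationary\<close> equal
    \<open>D powr \<epsilon> / E\<close>.\<close>
  define E where "E = exp (2 * \<epsilon>) + exp (- (2 * \<epsilon>))"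
  define C :: real where "C = exp 2 + exp (- 2)"
  define p where "p = exp (2 * \<epsilon>) / E"
  define b where "b = B * (exp 2 - exp (- 2)) / C"
  define w where "w = 1 / (4 * real n * \<epsilon>\<^sup>2)"
  have pos: "E > 0" "C > 0"
    by (simp_all add: E_def C_def add_pos_pos)
  have E2: "E \<ge> 2"
    using exp_ge_add_one_self[of "2 * \<epsilon>"] exp_ge_add_one_self[of "- (2 * \<epsilon>)"] unfolding E_def by linarith
  have p: "0 \<le> p" "p \<le> 1" "1 - p = exp (- (2 * \<epsilon>)) / E"
    using pos by (auto simp: p_def E_def field_simps)
  define D where "D = B * (2 / C)"
  have D: "D > 0"
    using \<open>B > 0\<close> pos by (simp add: D_def)
  have Bb: "B - b = D * exp (- 2)" "B + b = D * exp 2"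
    using pos by (auto simp: b_def D_def C_def field_simps)
  have powr_Bb: "(B - b) powr r = D powr r * exp (- (2 * r))"
    "(B + b) powr r = D powr r * exp (2 * r)" for r
    using D by (simp_all add: Bb powr_mult exp_powr_real mult.commute)
  have b: "\<bar>b\<bar> \<le> B"
  proof -
    have "B - b \<ge> 0" "B + b \<ge> 0"
      unfolding Bb using D by simp_all
    then show ?thesis by linarith
  qed
  have stationary: "p * (B - b) powr (q - 1) = (1 - p) * (B + b) powr (q - 1)"
    by (simp add: powr_Bb p(3)) (simp add: p_def \<epsilon>_def exp_minus field_simps)
  have w: "w \<ge> 0" "real k * w \<le> 1"
    using k \<open>n \<ge> 1\<close> \<epsilon>(1) unfolding w_def \<epsilon>_def[symmetric] by simp_all
  interpret H: hypercube M B q k X w p b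
    using assms(1) q(1) X w p(1,2) b stationary by unfold_locales simp_all

  \<comment> \<open>The Bayes risk is \<open>D powr q * C / E\<close>, at most
    \<open>B powr q * (2 / C) powr \<epsilon>\<close> as \<open>E \<ge> 2\<close>. Then
    \<open>2 / C \<le> exp (- 1)\<close> and \<open>exp \<epsilon> \<ge> 1 + \<epsilon> = q\<close>
    bound it by \<open>B powr q / q\<close>.\<close>
  have gap: "B powr q - H.bayes_risk \<ge> B powr q * (\<epsilon> / q)"
  proof -
    have "H.bayes_risk = D powr q * ((exp (2 * \<epsilon>) * exp (- (2 * q)) + exp (- (2 * \<epsilon>)) * exp (2 * q)) / E)"
      unfolding H.bayes_risk_def p(3) by (simp add: powr_Bb p_def algebra_simps add_divide_distrib)
    also have "exp (2 * \<epsilon>) * exp (- (2 * q)) + exp (- (2 * \<epsilon>)) * exp (2 * q) = C"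
      by (simp add: C_def \<epsilon>_def exp_add[symmetric] algebra_simps)
    also have "D powr q * (C / E) \<le> D powr q * (C / 2)"
      using E2 pos by (intro mult_left_mono divide_left_mono) auto
    also have "\<dots> = B powr q * (2 / C) powr \<epsilon>"
    proof -
      have "D powr q = B powr q * ((2 / C) powr \<epsilon> * (2 / C))"
        unfolding D_def using \<open>B > 0\<close> pos by (subst powr_mult) (simp_all add: \<epsilon>(3) powr_add)
      then show ?thesis
        using pos by simp
    qed
    also have "(2 / C) powr \<epsilon> \<le> exp (- 1) powr \<epsilon>"
    proof (intro powr_mono2)
      have "2 * exp 1 \<le> exp 1 * exp (1::real)"
        using exp_ge_add_one_self[of 1] by simp
      also have "\<dots> \<le> C"
        by (simp add: C_def exp_add[symmetric])
      finally show "2 / C \<le> exp (- 1)"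
        using pos by (simp add: exp_minus field_simps)
    qed (use pos \<epsilon> in auto)
    also have "exp (- 1) powr \<epsilon> \<le> 1 / q"
    proof -
      have "exp (- 1) powr \<epsilon> = 1 / exp \<epsilon>"
        unfolding exp_powr_real by (simp add: exp_minus inverse_eq_divide)
      also have "\<dots> \<le> 1 / q"
        using exp_ge_add_one_self[of \<epsilon>] q by (intro divide_left_mono) (auto simp: \<epsilon>(3))
      finally show ?thesis .
    qed
    finally have "H.bayes_risk \<le> B powr q * (1 / q)"
      by (simp add: mult_left_mono)
    moreover have "\<epsilon> / q = 1 - 1 / q"
      using q by (simp add: \<epsilon>_def field_simps)
    ultimately show ?thesis
      by (simp add: right_diff_distrib)
  qed

  \<comment> \<open>One observation loses at most
    \<open>w * 12 / 5 * \<epsilon>\<^sup>2 = 3 / (5 * n)\<close> of the coefficient, so Bernoulli's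
    inequality leaves \<open>2 / 5\<close> after \<open>n\<close>; and \<open>2 / 25\<close> is
    \<open>(2 / 5)\<^sup>2 / 2\<close>.\<close>
  have affinity: "2 / 25 \<le> ((1 - w * (1 - 2 * sqrt (p * (1 - p)))) ^ n)\<^sup>2 / 2"
  proof -
    have "sqrt (p * (1 - p)) = 1 / E"
      unfolding p(3) using pos by (simp add: p_def exp_minus real_sqrt_divide)
    then have "1 - 2 * sqrt (p * (1 - p)) = (E - 2) / E"
      using pos by (simp add: field_simps)
    also have "\<dots> \<le> (E - 2) / 2"
      using E2 by (intro divide_left_mono) auto
    also have "\<dots> \<le> 12 / 5 * \<epsilon>\<^sup>2"
      using exp_sum_bound[of \<epsilon>] \<epsilon> by (simp add: E_def)
    finally have "w * (1 - 2 * sqrt (p * (1 - p))) \<le> w * (12 / 5 * \<epsilon>\<^sup>2)"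
      using w by (intro mult_left_mono)
    also have "\<dots> = 3 / (5 * real n)"
      using \<open>n \<ge> 1\<close> \<epsilon> by (simp add: w_def field_simps)
    finally have "(1 - 3 / (5 * real n)) ^ n \<le> (1 - w * (1 - 2 * sqrt (p * (1 - p)))) ^ n"
      using \<open>n \<ge> 1\<close> by (intro power_mono) auto
    moreover have "(1 - 3 / (5 * real n)) ^ n \<ge> 1 + real n * (- (3 / (5 * real n)))"
      using Bernoulli_inequality[of "- (3 / (5 * real n))" n] \<open>n \<ge> 1\<close> by simp
    ultimately have "2 / 5 \<le> (1 - w * (1 - 2 * sqrt (p * (1 - p)))) ^ n"
      using \<open>n \<ge> 1\<close> by simp
    then have "(2 / 5)\<^sup>2 \<le> ((1 - w * (1 - 2 * sqrt (p * (1 - p)))) ^ n)\<^sup>2"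
      by (intro power_mono) auto
    then show ?thesis
      by (simp add: power2_eq_square)
  qed

  have lower: "minimax_excess_ge M B q n d (real k * w * (B powr q - H.bayes_risk) * (2 / 25))"
    by (rule H.minimax_lower_bound[OF assms(3) inj d]) (rule order.trans[OF affinity H.affinity_sqrt])
  \<comment> \<open>The right side is \<open>B powr q * k / (50 * n * \<epsilon> * q)\<close>; the
    passage from 50 to 90 absorbs the factor \<open>q * q\<close>.\<close>
  have "q / (90 * (q - 1)) * B powr q * (real k / (real n + 1))
      \<le> real k * w * (B powr q * (\<epsilon> / q)) * (2 / 25)"
  proof -
    have "q * q \<le> 9 / 5"
      using mult_mono[of q "11 / 10" q "11 / 10"] q by simp
    then have "q / 90 \<le> 1 / (50 * q)"
      using q by (simp add: field_simps)
    then have "(B powr q * real k / \<epsilon>) * (q / 90 * (1 / (real n + 1)))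
        \<le> (B powr q * real k / \<epsilon>) * (1 / (50 * q) * (1 / real n))"
      using \<epsilon> q \<open>n \<ge> 1\<close> by (intro mult_left_mono mult_mono divide_left_mono) auto
    then show ?thesis
      using \<epsilon>(1) q \<open>n \<ge> 1\<close> unfolding w_def \<epsilon>_def[symmetric] by (simp add: power2_eq_square field_simps)
  qed
  also have "\<dots> \<le> real k * w * (B powr q - H.bayes_risk) * (2 / 25)"
    using gap w by (intro mult_right_mono mult_left_mono) auto
  finally show ?thesis
    by (rule minimax_excess_ge_mono[OF lower])
qed

section \<open>Choice between the two constructions\<close>

theorem theorem8p4:
  fixes B q :: real and d n :: nat and M :: "'x measure"
  assumes "B > 0" and "d \<ge> 1" and "n \<ge> 1"
    and "q > 1 + sqrt (min (of_int \<lfloor>log 2 (real d)\<rfloor> / (4 * real n)) 1)"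
    and "separates_points M"
    and "\<exists>A. A \<subseteq> space M \<and> finite A \<and> int (card A) \<ge> \<lfloor>log 2 (2 * real d)\<rfloor>"
  shows "\<exists>G. G \<subseteq> prediction_functions M B \<and> finite G \<and> card G = d \<and>
    (\<forall>ghat. estimator M B n ghat \<longrightarrow>
      (\<exists>P. data_distribution M B P \<and>
        expected_risk q n P ghat - Min (risk q P ` G)
          \<ge> max (q / (90 * (q - 1))) (exp (-1)) * B powr q *
             min (of_int \<lfloor>log 2 (real (card G))\<rfloor> / (real n + 1)) 1))"
proof -
  define k where "k = nat \<lfloor>log 2 (real d)\<rfloor>"
  have log_nonneg: "log 2 (real d) \<ge> 0"
    using \<open>d \<ge> 1\<close> by simp
  then have k: "of_int \<lfloor>log 2 (real d)\<rfloor> = real k"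
    by (simp add: k_def)
  have d: "2 ^ k \<le> d"
  proof -
    have "real k \<le> log 2 (real d)"
      using log_nonneg by (simp add: k_def)
    then have "2 powr real k \<le> real d"
      using \<open>d \<ge> 1\<close> by (subst (asm) le_log_iff) auto
    then have "real (2 ^ k) \<le> real d"
      by (simp add: powr_realpow)
    then show ?thesis
      by (simp only: of_nat_le_iff)
  qed
  obtain A where A: "A \<subseteq> space M" "finite A" "int (card A) \<ge> \<lfloor>log 2 (2 * real d)\<rfloor>"
    using assms(6) by blast
  \<comment> \<open>The points suffice for a cube of dimension \<open>k\<close> and the one further
    point.\<close>
  have "\<lfloor>log 2 (2 * real d)\<rfloor> = int (Suc k)"
    using \<open>d \<ge> 1\<close> log_nonneg by (simp add: log_mult k_def)
  then have "card {..k} \<le> card A"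
    using A(3) by simp
  then obtain X where X: "X ` {..k} \<subseteq> A" "inj_on X {..k}"
    using card_le_inj[of "{..k}" A] A(2) by auto
  have X_space: "X j \<in> space M" if "j \<le> k" for j
    using X(1) A(1) that by auto
  have sqrt_less: "sqrt (min (real k / (4 * real n)) 1) < q - 1"
    using assms(4) unfolding k by simp
  moreover have "sqrt (min (real k / (4 * real n)) 1) \<ge> 0"
    by simp
  ultimately have q: "q > 1"
    by linarith
  let ?c = "max (q / (90 * (q - 1))) (exp (- 1)) * B powr q * min (real k / (real n + 1)) 1"
  have "minimax_excess_ge M B q n d ?c"
  proof (cases "q / (90 * (q - 1)) \<le> exp (- 1)")
    case True
    show ?thesis
      using deterministic_lower_bound[OF assms(1) q assms(5) X_space X(2) d, of n]
      by (simp only: max_absorb2[OF True])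
  next
    case False
    \<comment> \<open>A first constant above \<open>1 / 3\<close> forces \<open>q < 30 / 29\<close>,
      within the range of the noisy construction.\<close>
    have "exp (- 1) \<ge> 1 / (3::real)"
      using exp_le by (simp add: exp_minus field_simps)
    with False have "q / (90 * (q - 1)) > 1 / 3"
      by linarith
    then have q': "q \<le> 11 / 10"
      using q by (simp add: field_simps)
    \<comment> \<open>As \<open>(q - 1)\<^sup>2\<close> is below 1, the minimum is its first
      argument. This gives the mass condition, and \<open>k < n\<close>, so the minimum in the bound
      is not truncated at 1 either.\<close>
    have "min (real k / (4 * real n)) 1 < (q - 1)\<^sup>2"
      using sqrt_less by (metis real_sqrt_less_iff real_sqrt_unique not_less real_sqrt_le_iff less_eq_real_def diff_gt_0_iff_gt q real_sqrt_abs abs_of_pos)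
    moreover have "(q - 1)\<^sup>2 \<le> (1 / 10)\<^sup>2"
      using q q' by (intro power_mono) auto
    ultimately have less: "real k / (4 * real n) < (q - 1)\<^sup>2" and "real k / (4 * real n) < (1 / 10)\<^sup>2"
      by (auto simp: min_def power2_eq_square split: if_splits)
    then have "real k < real n"
      using \<open>n \<ge> 1\<close> by (simp add: field_simps power2_eq_square)
    then have "real k / (real n + 1) \<le> 1"
      by simp
    moreover have "real k \<le> 4 * real n * (q - 1)\<^sup>2"
      using less \<open>n \<ge> 1\<close> by (simp add: field_simps)
    ultimately show ?thesis
      using noisy_lower_bound[OF assms(1,3,5) X_space X(2) d q q'] False
      by (simp add: max_absorb1)
  qed
  then obtain G where G: "G \<subseteq> prediction_functions M B" "finite G" "card G = d" and
    lower: "\<forall>ghat. estimator M B n ghat \<longrightarrow>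
      (\<exists>P. data_distribution M B P \<and> expected_risk q n P ghat - Min (risk q P ` G) \<ge> ?c)"
    unfolding minimax_excess_ge_def by (elim exE conjE)
  show ?thesis
    using lower by (intro exI[of _ G] conjI G) (simp only: G(3) k)
qed

end
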